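(* Let $K$ be a preradicable (commutative, infinite) idempotent semifield, and let $p \in K[X]$ and $c \in K$. If $\deg p > 0$, then the inequality $\widehat{p}(x) \leqslant c$ has a solution $x$ in $K$ if and only if $p_0 \leqslant c$; and in that case it has a greatest solution.
   Context: A semiring is a commutative monoid $(S,+,0)$ with an associative multiplication having identity $1$, distributing over $+$, and with $0$ absorbing. A semifield is a semiring with $1\neq 0$ in which every nonzero element has a multiplicative inverse; it is idempotent if $x+x=x$ for all $x$. All idempotent semifields are assumed commutative and infinite. An idempotent semifield $K$ is ordered by $x\leqslant y \iff x+y=y$. $\mathbb{N}$ contains $0$ and $\mathbb{N}^*=\mathbb{N}\setminus\{0\}$. $K$ is preradicable if for all $y\in K$, $n\in\mathbb{N}^*$ there is a least element $x\in K$ with $x^n\geqslant y$. A polynomial $p\in K[X]$ is a formal polynomial $p=\sum_{j\in\mathbb{N}}p_jX^j$ (eventually zero sequence of coefficients), with polynomial function $\widehat p:K\to K$, $\widehat p(x)=\sum_j p_jx^j$; $\deg p$ is the maximum of $\{j:p_j\neq0\}$ ($-\infty$ for $p=0$). *)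

theory Defs
  imports "HOL-Computational_Algebra.Polynomial" "HOL-Library.Infinite_Typeclass"
begin

text \<open>
  Idempotent semifields are commutative and infinite by convention. The requirement
  \<open>1 \<noteq> 0\<close> is part of \<^class>\<open>comm_semiring_1\<close>. The relations \<open>\<le>\<close> and \<open><\<close> are
  determined by addition through the last two axioms.
\<close>

class idempotent_semifield = comm_semiring_1 + infinite + ord +
  assumes add_idem: "x + x = x"
    and ex_inverse: "x \<noteq> 0 \<Longrightarrow> \<exists>y. x * y = 1"
    and le_iff_add_eq: "x \<le> y \<longleftrightarrow> x + y = y"
    and less_iff_le_neq: "x < y \<longleftrightarrow> x \<le> y \<and> x \<noteq> y"
begin

subclass order
proof
  fix x y z
  show "x < y \<longleftrightarrow> x \<le> y \<and> \<not> y \<le> x"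
    by (metis le_iff_add_eq less_iff_le_neq add.commute add_idem)
  show "x \<le> x"
    by (simp add: le_iff_add_eq add_idem)
  show "x \<le> z" if "x \<le> y" "y \<le> z"
    using that by (metis le_iff_add_eq add.assoc)
  show "x = y" if "x \<le> y" "y \<le> x"
    using that by (metis le_iff_add_eq add.commute)
qed

end

class preradicable_idempotent_semifield = idempotent_semifield +
  assumes preradicable:
    "n > 0 \<Longrightarrow> \<exists>x. y \<le> x ^ n \<and> (\<forall>z. y \<le> z ^ n \<longrightarrow> x \<le> z)"

end

theory Submission
  imports Defs
begin

text \<open>
  The inequality holds at \<open>x\<close> if and only if every monomial satisfies \<open>p\<^sub>j x\<^sup>j \<le> c\<close>. Taking inverses,
  the preradicability of the semifield says that for \<open>j > 0\<close> and \<open>p\<^sub>j \<noteq> 0\<close> the solutions of this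
  form a principal down-set. Finite nonempty intersections of principal down-sets are again
  principal, because the order of a semifield has binary meets, \<open>(r\<^sup>-\<^sup>1 + s\<^sup>-\<^sup>1)\<^sup>-\<^sup>1\<close> for nonzero
  \<open>r\<close> and \<open>s\<close>.
\<close>

context idempotent_semifield
begin

lemma zero_le: "0 \<le> x"
  by (simp add: le_iff_add_eq)

lemma le_zero_iff: "x \<le> 0 \<longleftrightarrow> x = 0"
  by (simp add: le_iff_add_eq)

text \<open>Idempotent addition is the join of the order.\<close>

lemma add_le_iff: "x + y \<le> z \<longleftrightarrow> x \<le> z \<and> y \<le> z"
  by (metis le_iff_add_eq add.assoc add.commute add_idem)

lemma mult_left_mono: "x \<le> y \<Longrightarrow> z * x \<le> z * y"
  by (metis le_iff_add_eq distrib_left)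

lemma mult_mono: "x \<le> y \<Longrightarrow> z \<le> w \<Longrightarrow> x * z \<le> y * w"
  by (metis mult_left_mono mult.commute order_trans)

lemma power_mono: "x \<le> y \<Longrightarrow> x ^ n \<le> y ^ n"
  by (induction n) (auto intro: mult_mono)

lemma mult_le_iff_le_mult:
  assumes "a * b = 1"
  shows "a * x \<le> y \<longleftrightarrow> x \<le> b * y"
proof -
  have "b * (a * x) = x" "a * (b * y) = y"
    using assms by (metis mult.assoc mult.commute mult_1_left)+
  then show ?thesis
    by (metis mult_left_mono)
qed

text \<open>Both sides amount to \<open>1 \<le> x * y'\<close>, by moving one unit across at a time.
  Inverses enter as witnesses, since the class only asserts that they exist.\<close>

lemma inverse_le_inverse_iff:
  assumes "x * x' = 1" "y * y' = 1"
  shows "x' \<le> y' \<longleftrightarrow> y \<le> x"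
proof -
  have "x' \<le> y' \<longleftrightarrow> x' * 1 \<le> y'"
    by simp
  also have "\<dots> \<longleftrightarrow> 1 \<le> x * y'"
    using assms by (simp only: mult_le_iff_le_mult mult.commute[of x' x])
  also have "\<dots> \<longleftrightarrow> y * 1 \<le> x"
    using mult_le_iff_le_mult[of y y' 1 x] assms by (simp add: mult.commute)
  finally show ?thesis
    by simp
qed

lemma ex_meet: "\<exists>m. \<forall>y. y \<le> r \<and> y \<le> s \<longleftrightarrow> y \<le> m"
proof (cases "r = 0 \<or> s = 0")
  case True
  then show ?thesis
    by (metis zero_le le_zero_iff)
next
  case False
  then obtain r' s' where inv: "r' * r = 1" "s' * s = 1"
    by (metis ex_inverse mult.commute)
  \<comment> \<open>A zero sum would force its summand \<open>r'\<close> to be zero, but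
    \<open>r'\<close> is a unit.\<close>
  then have "r' + s' \<noteq> 0"
    by (metis add_le_iff le_zero_iff order_refl mult_zero_left zero_neq_one)
  then obtain m where m: "(r' + s') * m = 1"
    using ex_inverse by blast
  have "y \<le> r \<and> y \<le> s \<longleftrightarrow> y \<le> m" for y
  proof (cases "y = 0")
    case False
    then obtain y' where y': "y' * y = 1"
      by (metis ex_inverse mult.commute)
    show ?thesis
      using inverse_le_inverse_iff[OF y' m] inverse_le_inverse_iff[OF y' inv(1)]
        inverse_le_inverse_iff[OF y' inv(2)] by (simp add: add_le_iff)
  qed (simp add: zero_le)
  then show ?thesis
    by blast
qed

text \<open>Induction with \<open>ex_meet\<close>. An empty intersection would be the whole
  semifield, which is not principal: being infinite, it has no greatest element.\<close>

lemma ex_principal_Inter: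
  assumes "finite I" "I \<noteq> {}" "\<And>i. i \<in> I \<Longrightarrow> \<exists>r. \<forall>y. P i y \<longleftrightarrow> y \<le> r"
  shows "\<exists>r. \<forall>y. (\<forall>i\<in>I. P i y) \<longleftrightarrow> y \<le> r"
  using assms
proof (induction rule: finite_ne_induct)
  case (insert i I)
  then obtain r s where "\<And>y. P i y \<longleftrightarrow> y \<le> r" "\<And>y. (\<forall>j\<in>I. P j y) \<longleftrightarrow> y \<le> s"
    by (metis insertCI)
  then show ?case
    using ex_meet[of r s] by simp
qed simp

lemma sum_le_iff:
  "finite I \<Longrightarrow> sum f I \<le> c \<longleftrightarrow> (\<forall>i\<in>I. f i \<le> c)"
  by (induction rule: finite_induct) (simp_all add: zero_le add_le_iff)

end

context preradicable_idempotent_semifield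
begin

lemma ex_greatest_power_le:
  assumes "n > 0"
  shows "\<exists>r. \<forall>y. y ^ n \<le> d \<longleftrightarrow> y \<le> r"
proof (cases "d = 0")
  case True
  \<comment> \<open>Here \<open>d\<close> has no inverse to work with. Powers of units are units, so
    \<open>y = 0\<close> is the only solution and \<open>r = 0\<close> serves.\<close>
  have "y ^ n \<noteq> 0" if y: "y \<noteq> 0" for y
  proof -
    obtain z where "y * z = 1"
      using ex_inverse y by blast
    then have "y ^ n * z ^ n = 1"
      by (metis power_mult_distrib power_one)
    then show ?thesis
      by (metis mult_zero_left zero_neq_one)
  qed
  then have "y ^ n \<le> 0 \<longleftrightarrow> y \<le> 0" for y
    unfolding le_zero_iff using assms zero_power by blast
  then show ?thesis
    using True by blast
next
  case False
  then obtain d' where d': "d' * d = 1"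
    by (metis ex_inverse mult.commute)
  obtain x where x: "d' \<le> x ^ n" "\<And>z. d' \<le> z ^ n \<Longrightarrow> x \<le> z"
    using preradicable[OF assms] by blast
  have "x \<noteq> 0"
    using x(1) d' assms by (metis le_zero_iff zero_power mult_zero_left zero_neq_one)
  \<comment> \<open>Inversion reverses the order, so the inverse of the least \<open>x\<close> with
    \<open>d' \<le> x ^ n\<close> is the greatest solution.\<close>
  then obtain r where r: "x * r = 1"
    using ex_inverse by blast
  have "y ^ n \<le> d \<longleftrightarrow> y \<le> r" for y
  proof (cases "y = 0")
    case True
    then show ?thesis
      using assms by (simp add: zero_le zero_power)
  next
    case False
    then obtain z where z: "z * y = 1"
      by (metis ex_inverse mult.commute)
    then have zn: "z ^ n * y ^ n = 1"
      by (metis power_mult_distrib power_one)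
    \<comment> \<open>Left to right is the minimality of \<open>x\<close>, right to left the
      monotonicity of powers.\<close>
    have "d' \<le> z ^ n \<longleftrightarrow> x \<le> z"
      using x power_mono order_trans by blast
    then show ?thesis
      by (simp add: inverse_le_inverse_iff[OF zn d'] inverse_le_inverse_iff[OF z r])
  qed
  then show ?thesis
    by blast
qed

lemma ex_greatest_monomial_le:
  assumes "n > 0" "a \<noteq> 0"
  shows "\<exists>r. \<forall>y. a * y ^ n \<le> c \<longleftrightarrow> y \<le> r"
proof -
  obtain b where "a * b = 1"
    using ex_inverse assms(2) by blast
  then show ?thesis
    using ex_greatest_power_le[OF assms(1), of "b * c"] by (simp add: mult_le_iff_le_mult)
qed

end

theorem proposition6p3:
  fixes p :: "'a::preradicable_idempotent_semifield poly" and c :: 'a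
  assumes "degree p > 0"
  shows "((\<exists>x. poly p x \<le> c) \<longleftrightarrow> coeff p 0 \<le> c) \<and>
    (coeff p 0 \<le> c \<longrightarrow> (\<exists>x. poly p x \<le> c \<and> (\<forall>y. poly p y \<le> c \<longrightarrow> y \<le> x)))"
proof -
  \<comment> \<open>Zero coefficients are left out, as they restrict nothing and so give no
    principal down-set. The leading term keeps \<open>I\<close> nonempty.\<close>
  define I where "I = {j. 0 < j \<and> j \<le> degree p \<and> coeff p j \<noteq> 0}"
  have "finite I"
    unfolding I_def by (rule finite_subset[of _ "{..degree p}"]) auto
  moreover have "degree p \<in> I"
    using assms by (auto simp: I_def)
  ultimately obtain r where r: "\<And>y. (\<forall>j\<in>I. coeff p j * y ^ j \<le> c) \<longleftrightarrow> y \<le> r"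
    using ex_principal_Inter[of I "\<lambda>j y. coeff p j * y ^ j \<le> c"] ex_greatest_monomial_le
    unfolding I_def by blast
  \<comment> \<open>The constant term is a condition free of \<open>y\<close>. Hence the solution
    set is either empty or the down-set of \<open>r\<close>, which gives both claims.\<close>
  have "poly p y \<le> c \<longleftrightarrow> coeff p 0 \<le> c \<and> y \<le> r" for y
  proof -
    have "poly p y \<le> c \<longleftrightarrow> (\<forall>j\<le>degree p. coeff p j * y ^ j \<le> c)"
      by (simp add: poly_altdef sum_le_iff Ball_def)
    also have "\<dots> \<longleftrightarrow> coeff p 0 \<le> c \<and> (\<forall>j\<in>I. coeff p j * y ^ j \<le> c)"
    proof (intro iffI conjI allI impI)
      fix j
      assume "coeff p 0 \<le> c \<and> (\<forall>j\<in>I. coeff p j * y ^ j \<le> c)" "j \<le> degree p"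
      then show "coeff p j * y ^ j \<le> c"
        by (cases "j = 0"; cases "coeff p j = 0") (auto simp: I_def zero_le)
    qed (force simp: I_def)+
    finally show ?thesis
      by (simp add: r)
  qed
  then show ?thesis
    by auto
qed

end
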